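(* Let $\ell>0$ and $b\neq 0$ be integers satisfying $\ell^2+4b\geq 0$, and let $\mathbf{s}=(s_1,s_2,\ldots)$ be defined by $s_0=0$, $s_1=1$ and $s_n=\ell s_{n-1}+b s_{n-2}$ for $n\geq 2$. Then the lecture hall generating function $f_n^{(\mathbf{s})}(q)$ is self-reciprocal for all $n\geq 0$ if and only if $b=-1$. Moreover, if $b\neq -1$, there is an integer $n_0=n_0(b,\ell)$ such that for all $n\geq n_0$, $f_n^{(\mathbf{s})}(q)$ is not self-reciprocal, and consequently $f_n^{(\mathbf{s})}(q)$ is not of the form $\big((1-q^{e_1})(1-q^{e_2})\cdots(1-q^{e_n})\big)^{-1}$ for any positive integers $e_1,\ldots,e_n$.
   Context: For a sequence $\mathbf{s}=(s_i)_{i\geq 1}$ of positive integers, the set of $\mathbf{s}$-lecture hall partitions of length $n$ is $\mathcal{L}_n^{(\mathbf{s})}=\{\lambda\in\mathbb{Z}^n : 0\leq \lambda_1/s_1\leq \lambda_2/s_2\leq\cdots\leq \lambda_n/s_n\}$, and $f_n^{(\mathbf{s})}(q)=\sum_{\lambda\in\mathcal{L}_n^{(\mathbf{s})}} q^{\lambda_1+\cdots+\lambda_n}$ (a rational function of $q$). A rational function $r(q)$ is self-reciprocal if there is a nonnegative integer $k$ with $r(1/q)=\pm q^k r(q)$. *)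

theory Defs
  imports "HOL-Computational_Algebra.Computational_Algebra"
    "HOL-Computational_Algebra.Field_as_Ring" "HOL-Library.FuncSet"
begin

section \<open>Rational functions in one indeterminate\<close>

text \<open>
  Rational functions in \<open>q\<close> with rational coefficients are the elements of
  \<^typ>\<open>rat poly fract\<close>, and \<open>quot_of_fract\<close> gives the reduced pair of
  numerator and (monic) denominator.
\<close>

abbreviation ratfun_num :: "rat poly fract \<Rightarrow> rat poly" where
  "ratfun_num r \<equiv> fst (quot_of_fract r)"

abbreviation ratfun_den :: "rat poly fract \<Rightarrow> rat poly" where
  "ratfun_den r \<equiv> snd (quot_of_fract r)"

definition ratfun_q :: "rat poly fract" where
  "ratfun_q = to_fract [:0, 1:]"

text \<open>
  Substitution \<open>r(x)\<close> of a rational function \<open>x\<close> for \<open>q\<close>. It is meaningful when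
  the denominator does not vanish at \<open>x\<close>, in particular for every nonconstant \<open>x\<close>;
  it is used below only for \<open>x = 1/q\<close>.
\<close>

definition ratfun_subst :: "rat poly fract \<Rightarrow> rat poly fract \<Rightarrow> rat poly fract" where
  "ratfun_subst r x =
     poly (map_poly (\<lambda>c. to_fract [:c:]) (ratfun_num r)) x /
     poly (map_poly (\<lambda>c. to_fract [:c:]) (ratfun_den r)) x"

definition self_reciprocal :: "rat poly fract \<Rightarrow> bool" where
  "self_reciprocal r \<longleftrightarrow>
     (\<exists>k::nat. ratfun_subst r (1 / ratfun_q) = ratfun_q ^ k * r \<or>
              ratfun_subst r (1 / ratfun_q) = - (ratfun_q ^ k * r))"

text \<open>
  \<open>F\<close> is the power series expansion at \<open>0\<close> of \<open>r\<close>. Since \<open>ratfun_den r\<close> is never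
  zero and power series over a field have no zero divisors, \<open>r\<close> and \<open>F\<close> determine
  each other.
\<close>

definition ratfun_expansion :: "rat poly fract \<Rightarrow> rat fps \<Rightarrow> bool" where
  "ratfun_expansion r F \<longleftrightarrow> F * fps_of_poly (ratfun_den r) = fps_of_poly (ratfun_num r)"

definition ratfun_of_fps :: "rat fps \<Rightarrow> rat poly fract" where
  "ratfun_of_fps F = (THE r. ratfun_expansion r F)"

section \<open>Lecture hall partitions\<close>

text \<open>
  Sequences are indexed from \<open>1\<close>: the value \<open>s 0\<close> is irrelevant, and vectors in
  \<open>\<int>\<^sup>n\<close> are extensional functions on \<open>{1..n}\<close>.
\<close>

definition lecture_hall_partitions :: "(nat \<Rightarrow> int) \<Rightarrow> nat \<Rightarrow> (nat \<Rightarrow> int) set" where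
  "lecture_hall_partitions s n =
     {x \<in> {1..n} \<rightarrow>\<^sub>E UNIV.
        (n \<ge> 1 \<longrightarrow> 0 \<le> rat_of_int (x 1) / rat_of_int (s 1)) \<and>
        (\<forall>i\<in>{1..<n}. rat_of_int (x i) / rat_of_int (s i)
                     \<le> rat_of_int (x (i + 1)) / rat_of_int (s (i + 1)))}"

text \<open>
  For positive \<open>s\<close> all entries of a lecture hall partition are nonnegative, so there
  are no terms with negative exponent and every coefficient is the cardinality of a
  finite set.
\<close>

definition lecture_hall_fps :: "(nat \<Rightarrow> int) \<Rightarrow> nat \<Rightarrow> rat fps" where
  "lecture_hall_fps s n =
     Abs_fps (\<lambda>m. of_nat (card {x \<in> lecture_hall_partitions s n. (\<Sum>i=1..n. x i) = int m}))"

definition lecture_hall_gf :: "(nat \<Rightarrow> int) \<Rightarrow> nat \<Rightarrow> rat poly fract" where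
  "lecture_hall_gf s n = ratfun_of_fps (lecture_hall_fps s n)"

section \<open>The generating function is a rational function\<close>

text \<open>
  The rest of this theory shows that the definite description in \<open>ratfun_of_fps\<close>
  is well-defined for lecture hall generating functions, and that the substitution
  \<open>q \<mapsto> 1/q\<close> never divides by zero.
\<close>

lemma ratfun_expansion_Fract_iff:
  assumes "Q \<noteq> 0"
  shows "ratfun_expansion (Fract P Q) F \<longleftrightarrow> F * fps_of_poly Q = fps_of_poly P"
proof -
  define N D where "N = ratfun_num (Fract P Q)" and "D = ratfun_den (Fract P Q)"
  have D0: "D \<noteq> 0" unfolding D_def by simp
  have "Fract N D = Fract P Q" unfolding N_def D_def by simp
  hence "N * Q = P * D" using assms D0 by (simp add: eq_fract)
  hence eq: "fps_of_poly N * fps_of_poly Q = fps_of_poly P * fps_of_poly D"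
    by (metis fps_of_poly_mult)
  have D0': "fps_of_poly D \<noteq> 0" and Q0: "fps_of_poly Q \<noteq> 0"
    using D0 assms by (metis fps_of_poly_0 fps_of_poly_eq_iff)+
  have "F * fps_of_poly D = fps_of_poly N \<longleftrightarrow>
        (F * fps_of_poly Q) * fps_of_poly D = fps_of_poly N * fps_of_poly Q"
    using Q0 mult_right_cancel[OF Q0, of "F * fps_of_poly D" "fps_of_poly N"]
    by (simp add: mult_ac)
  also have "\<dots> \<longleftrightarrow> F * fps_of_poly Q = fps_of_poly P"
    using D0' unfolding eq by simp
  finally show ?thesis unfolding ratfun_expansion_def N_def D_def .
qed

lemma ratfun_expansion_unique:
  assumes "ratfun_expansion r F" "ratfun_expansion r' F"
  shows "r = r'"
proof -
  have "fps_of_poly (ratfun_num r * ratfun_den r') = fps_of_poly (ratfun_num r' * ratfun_den r)"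
    using assms[unfolded ratfun_expansion_def, symmetric]
    by (simp add: fps_of_poly_mult mult_ac)
  hence "ratfun_num r * ratfun_den r' = ratfun_num r' * ratfun_den r"
    by (simp only: fps_of_poly_eq_iff)
  hence "Fract (ratfun_num r) (ratfun_den r) = Fract (ratfun_num r') (ratfun_den r')"
    by (simp add: eq_fract del: Fract_quot_of_fract)
  thus ?thesis by simp
qed

lemma ratfun_of_fps_eqI:
  assumes "ratfun_expansion r F"
  shows "ratfun_of_fps F = r"
  unfolding ratfun_of_fps_def using assms ratfun_expansion_unique by blast

lemma ratfun_subst_reciprocal_den_nonzero:
  "poly (map_poly (\<lambda>c. to_fract [:c:]) (ratfun_den r)) (1 / ratfun_q) \<noteq> 0"
proof -
  define D where "D = ratfun_den r"
  have D0: "D \<noteq> 0" unfolding D_def by simp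
  have q0: "ratfun_q \<noteq> 0" by (simp add: ratfun_q_def)
  have "poly (map_poly (\<lambda>c. to_fract [:c:]) p) (1 / ratfun_q) * ratfun_q ^ degree p =
        to_fract (reflect_poly p)" for p :: "rat poly"
  proof (induction p)
    case (pCons c p)
    show ?case
    proof (cases "p = 0")
      case False
      have "poly (map_poly (\<lambda>c. to_fract [:c:]) (pCons c p)) (1 / ratfun_q) *
              ratfun_q ^ degree (pCons c p) =
            to_fract [:c:] * ratfun_q ^ Suc (degree p) +
            poly (map_poly (\<lambda>c. to_fract [:c:]) p) (1 / ratfun_q) * ratfun_q ^ degree p"
        using False q0 by (simp add: map_poly_pCons field_simps)
      also have "\<dots> = to_fract ([:c:] * [:0, 1:] ^ Suc (degree p) + reflect_poly p)"
      proof -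
        have pow: "to_fract (x ^ n) = to_fract x ^ n" for x :: "rat poly" and n
          by (induction n) auto
        show ?thesis unfolding pCons.IH by (simp only: ratfun_q_def to_fract_add to_fract_mult pow)
      qed
      also have "[:c:] * [:0, 1:] ^ Suc (degree p) + reflect_poly p = reflect_poly (pCons c p)"
        using False by (simp add: reflect_poly_pCons' monom_altdef)
      finally show ?thesis .
    qed (simp add: map_poly_pCons)
  qed simp
  from this[of D] D0 have "poly (map_poly (\<lambda>c. to_fract [:c:]) D) (1 / ratfun_q) \<noteq> 0"
    by auto
  thus ?thesis unfolding D_def .
qed

context
  fixes s :: "nat \<Rightarrow> int" and n :: nat
  assumes s_pos: "\<And>i. i \<ge> 1 \<Longrightarrow> s i > 0"
begin

text \<open>
  The integer vectors \<open>(0, \<dots>, 0, s\<^sub>j, \<dots>, s\<^sub>n)\<close> generate the lecture hall cone, and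
  \<open>lh_coord x j\<close> is the coordinate of \<open>x\<close> along this generator. Splitting off integer
  parts of one coordinate at a time reduces the cone to the finite set of integer points
  in the half-open parallelepiped.
\<close>

private definition ratio :: "(nat \<Rightarrow> int) \<Rightarrow> nat \<Rightarrow> rat" where
  "ratio x i = (if i = 0 then 0 else of_int (x i) / of_int (s i))"

private definition lh_coord :: "(nat \<Rightarrow> int) \<Rightarrow> nat \<Rightarrow> rat" where
  "lh_coord x i = ratio x i - ratio x (i - 1)"

private definition L :: "nat \<Rightarrow> (nat \<Rightarrow> int) set" where
  "L j = {x \<in> {1..n} \<rightarrow>\<^sub>E UNIV. \<forall>i\<in>{1..n}. 0 \<le> lh_coord x i \<and> (i \<le> j \<longrightarrow> lh_coord x i < 1)}"

private definition gf :: "(nat \<Rightarrow> int) set \<Rightarrow> rat fps" where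
  "gf A = Abs_fps (\<lambda>m. of_nat (card {x \<in> A. (\<Sum>i=1..n. x i) = int m}))"

private definition shift :: "nat \<Rightarrow> (nat \<Rightarrow> int) \<Rightarrow> nat \<Rightarrow> int" where
  "shift j x = (\<lambda>i\<in>{1..n}. x i + (if i \<ge> j then s i else 0))"

private definition unshift :: "nat \<Rightarrow> (nat \<Rightarrow> int) \<Rightarrow> nat \<Rightarrow> int" where
  "unshift j x = (\<lambda>i\<in>{1..n}. x i - (if i \<ge> j then s i else 0))"

private lemma L_0: "L 0 = lecture_hall_partitions s n"
proof -
  have "(\<forall>i\<in>{1..n}. 0 \<le> lh_coord x i) \<longleftrightarrow>
          (n \<ge> 1 \<longrightarrow> 0 \<le> rat_of_int (x 1) / rat_of_int (s 1)) \<and>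
          (\<forall>i\<in>{1..<n}. rat_of_int (x i) / rat_of_int (s i)
                     \<le> rat_of_int (x (i + 1)) / rat_of_int (s (i + 1)))" (is "?l \<longleftrightarrow> ?r") for x
  proof
    assume l: ?l
    show ?r
    proof (intro conjI impI ballI)
      assume "n \<ge> 1"
      with l have "0 \<le> lh_coord x 1" by auto
      thus "0 \<le> rat_of_int (x 1) / rat_of_int (s 1)" by (simp add: lh_coord_def ratio_def)
    next
      fix i assume "i \<in> {1..<n}"
      with l have "0 \<le> lh_coord x (Suc i)" by auto
      thus "rat_of_int (x i) / rat_of_int (s i) \<le> rat_of_int (x (i + 1)) / rat_of_int (s (i + 1))"
        using \<open>i \<in> {1..<n}\<close> by (simp add: lh_coord_def ratio_def)
    qed
  next
    assume r: ?r
    show ?l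
    proof
      fix i assume i: "i \<in> {1..n}"
      show "0 \<le> lh_coord x i"
      proof (cases "i = 1")
        case True
        thus ?thesis using r i by (simp add: lh_coord_def ratio_def)
      next
        case False
        then obtain k where k: "i = Suc k" "k \<in> {1..<n}" using i by (cases i) auto
        thus ?thesis using r by (auto simp: lh_coord_def ratio_def)
      qed
    qed
  qed
  thus ?thesis unfolding L_def lecture_hall_partitions_def by auto
qed

private lemma coord_shift:
  assumes "i \<in> {1..n}" "j \<ge> 1"
  shows "lh_coord (shift j x) i = lh_coord x i + (if i = j then 1 else 0)"
    and "lh_coord (unshift j x) i = lh_coord x i - (if i = j then 1 else 0)"
proof -
  have r: "ratio (shift j x) k = ratio x k + (if k \<ge> j then 1 else 0)"
          "ratio (unshift j x) k = ratio x k - (if k \<ge> j then 1 else 0)" if "k \<le> n" for k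
    using that s_pos[of k] assms(2)
    by (auto simp: ratio_def shift_def unshift_def add_divide_distrib diff_divide_distrib)
  have "i - 1 \<le> n" "i \<le> n" using assms by auto
  thus "lh_coord (shift j x) i = lh_coord x i + (if i = j then 1 else 0)"
    and "lh_coord (unshift j x) i = lh_coord x i - (if i = j then 1 else 0)"
    using assms unfolding lh_coord_def by (auto simp: r)
qed

private lemma ratio_bounds:
  assumes "x \<in> L j" "i \<le> n"
  shows "0 \<le> ratio x i" and "i \<le> j \<Longrightarrow> ratio x i \<le> of_nat i"
proof -
  have "0 \<le> ratio x i \<and> (i \<le> j \<longrightarrow> ratio x i \<le> of_nat i)"
    using assms(2)
  proof (induction i)
    case (Suc i)
    have "0 \<le> lh_coord x (Suc i)" "Suc i \<le> j \<longrightarrow> lh_coord x (Suc i) < 1"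
      using assms(1) Suc.prems unfolding L_def by auto
    thus ?case using Suc by (auto simp: lh_coord_def)
  qed (simp add: ratio_def)
  thus "0 \<le> ratio x i" and "i \<le> j \<Longrightarrow> ratio x i \<le> of_nat i" by auto
qed

private lemma L_nonneg:
  assumes "x \<in> L j" "i \<in> {1..n}"
  shows "0 \<le> x i"
  using ratio_bounds(1)[OF assms(1), of i] assms(2) s_pos[of i]
  by (auto simp: ratio_def zero_le_divide_iff)

private lemma finite_level: "finite {x \<in> L j. (\<Sum>i=1..n. x i) = int m}"
proof (rule finite_subset)
  show "{x \<in> L j. (\<Sum>i=1..n. x i) = int m} \<subseteq> {1..n} \<rightarrow>\<^sub>E {0..int m}"
  proof
    fix x assume "x \<in> {x \<in> L j. (\<Sum>i=1..n. x i) = int m}"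
    hence x: "x \<in> L j" "(\<Sum>i=1..n. x i) = int m" by auto
    have "x i \<in> {0..int m}" if "i \<in> {1..n}" for i
    proof -
      have "x i \<le> (\<Sum>i=1..n. x i)" using that L_nonneg[OF x(1)] by (intro member_le_sum) auto
      thus ?thesis using x(2) L_nonneg[OF x(1) that] by auto
    qed
    thus "x \<in> {1..n} \<rightarrow>\<^sub>E {0..int m}" using x(1) unfolding L_def by (auto simp: PiE_def)
  qed
qed (intro finite_PiE; simp)

private lemma finite_L_n: "finite (L n)"
proof (rule finite_subset)
  show "L n \<subseteq> (\<Pi>\<^sub>E i\<in>{1..n}. {0..int i * s i})"
  proof
    fix x assume x: "x \<in> L n"
    have "x i \<in> {0..int i * s i}" if "i \<in> {1..n}" for i
    proof -
      have "ratio x i \<le> of_nat i" using ratio_bounds(2)[OF x, of i] that by simp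
      hence "rat_of_int (x i) \<le> of_int (int i * s i)"
        using that s_pos[of i] by (simp add: ratio_def divide_simps)
      thus ?thesis using L_nonneg[OF x that] by (simp only: of_int_le_iff atLeastAtMost_iff)
    qed
    thus "x \<in> (\<Pi>\<^sub>E i\<in>{1..n}. {0..int i * s i})" using x unfolding L_def by (auto simp: PiE_def)
  qed
qed (intro finite_PiE; simp)

private lemma gf_step:
  assumes "j < n"
  shows "\<exists>Q. Q \<noteq> 0 \<and> gf (L j) * fps_of_poly Q = gf (L (Suc j))"
proof -
  define D where "D = nat (\<Sum>i\<in>{Suc j..n}. s i)"
  have sum_pos: "(\<Sum>i\<in>{Suc j..n}. s i) > 0"
    using assms s_pos by (intro sum_pos) auto
  have D: "int D = (\<Sum>i\<in>{Suc j..n}. s i)" "D > 0"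
    unfolding D_def using sum_pos by auto
  have sum_aux: "(\<Sum>i=1..n. if i \<ge> Suc j then s i else 0) = int D"
    unfolding D(1) by (intro sum.mono_neutral_cong_right) auto
  have sum_shift: "(\<Sum>i=1..n. shift (Suc j) x i) = (\<Sum>i=1..n. x i) + int D"
    and sum_unshift: "(\<Sum>i=1..n. unshift (Suc j) x i) = (\<Sum>i=1..n. x i) - int D" for x
    by (simp_all add: shift_def unshift_def sum.distrib sum_subtractf sum_aux[simplified])
  have inv: "shift (Suc j) (unshift (Suc j) x) = x" "unshift (Suc j) (shift (Suc j) x) = x"
    if "x \<in> {1..n} \<rightarrow>\<^sub>E UNIV" for x
    using that by (auto simp: shift_def unshift_def fun_eq_iff PiE_def extensional_def)
  have mem: "shift (Suc j) x \<in> {1..n} \<rightarrow>\<^sub>E UNIV" "unshift (Suc j) x \<in> {1..n} \<rightarrow>\<^sub>E UNIV" for x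
    by (auto simp: shift_def unshift_def)
  define H where "H m = {x \<in> L j. (\<Sum>i=1..n. x i) = int m}" for m
  define K where "K m = {x \<in> L (Suc j). (\<Sum>i=1..n. x i) = int m}" for m
  define G where "G m = {x \<in> L j. (\<Sum>i=1..n. x i) = int m \<and> lh_coord x (Suc j) \<ge> 1}" for m
  have L_Suc: "L (Suc j) = {x \<in> L j. \<not> lh_coord x (Suc j) \<ge> 1}"
  proof -
    have "(\<forall>i\<in>{1..n}. 0 \<le> lh_coord x i \<and> (i \<le> Suc j \<longrightarrow> lh_coord x i < 1)) \<longleftrightarrow>
          (\<forall>i\<in>{1..n}. 0 \<le> lh_coord x i \<and> (i \<le> j \<longrightarrow> lh_coord x i < 1)) \<and>
          lh_coord x (Suc j) < 1" for x
    proof -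
      have "Suc j \<in> {1..n}" using assms by auto
      thus ?thesis unfolding le_Suc_eq by blast
    qed
    thus ?thesis unfolding L_def not_le by blast
  qed
  have card_H: "card (H m) = card (K m) + card (G m)" for m
  proof -
    have "H m = K m \<union> G m" "K m \<inter> G m = {}"
      unfolding H_def K_def G_def L_Suc by auto
    moreover have "finite (H m)" unfolding H_def by (rule finite_level)
    ultimately show ?thesis by (simp add: card_Un_disjoint)
  qed
  have card_G: "card (G m) = (if m < D then 0 else card (H (m - D)))" for m
  proof -
    have un: "unshift (Suc j) x \<in> L j" if "x \<in> L j" "lh_coord x (Suc j) \<ge> 1" for x
      using that mem coord_shift(2)[of _ "Suc j" x] unfolding L_def by auto
    have sh: "shift (Suc j) x \<in> L j" "lh_coord (shift (Suc j) x) (Suc j) \<ge> 1" if "x \<in> L j" for x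
      using that mem coord_shift(1)[of _ "Suc j" x] assms unfolding L_def by auto
    have L_E: "x \<in> {1..n} \<rightarrow>\<^sub>E UNIV" if "x \<in> L j" for x using that unfolding L_def by auto
    show ?thesis
    proof (cases "m < D")
      case True
      have "x \<notin> G m" for x
      proof
        assume x: "x \<in> G m"
        hence "unshift (Suc j) x \<in> L j" using un unfolding G_def by auto
        hence "0 \<le> (\<Sum>i=1..n. unshift (Suc j) x i)" by (intro sum_nonneg L_nonneg)
        thus False using x True unfolding sum_unshift G_def by auto
      qed
      hence "G m = {}" by blast
      thus ?thesis using True by simp
    next
      case False
      have "bij_betw (shift (Suc j)) (H (m - D)) (G m)"
      proof (rule bij_betwI[where g = "unshift (Suc j)"])
        show "shift (Suc j) \<in> H (m - D) \<rightarrow> G m"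
          using sh False unfolding H_def G_def by (auto simp: sum_shift[unfolded One_nat_def] of_nat_diff)
        show "unshift (Suc j) \<in> G m \<rightarrow> H (m - D)"
          using un False unfolding H_def G_def by (auto simp: sum_unshift[unfolded One_nat_def] of_nat_diff)
      qed (use inv L_E in \<open>auto simp: H_def G_def\<close>)
      thus ?thesis using False by (simp add: bij_betw_same_card)
    qed
  qed
  have "gf (L j) = gf (L (Suc j)) + fps_X ^ D * gf (L j)"
  proof (rule fps_ext)
    fix m
    have "gf (L j) $ k = of_nat (card (H k))" "gf (L (Suc j)) $ k = of_nat (card (K k))" for k
      unfolding gf_def H_def K_def by (rule fps_nth_Abs_fps)+
    thus "gf (L j) $ m = (gf (L (Suc j)) + fps_X ^ D * gf (L j)) $ m"
      using card_H[of m] card_G[of m] by (simp add: fps_X_power_mult_nth)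
  qed
  hence "gf (L j) * fps_of_poly (1 - monom 1 D) = gf (L (Suc j))"
    by (simp add: fps_of_poly_diff fps_of_poly_monom' algebra_simps)
  moreover have "coeff (1 - monom (1::rat) D) 0 \<noteq> 0" using D(2) by simp
  hence "1 - monom (1::rat) D \<noteq> 0" by (metis coeff_0)
  ultimately show ?thesis by blast
qed

private lemma gf_steps: "j \<le> n \<Longrightarrow> \<exists>Q. Q \<noteq> 0 \<and> gf (L 0) * fps_of_poly Q = gf (L j)"
proof (induction j)
  case 0
  show ?case by (intro exI[of _ 1]) simp
next
  case (Suc j)
  then obtain Q Q' where "Q \<noteq> 0" "gf (L 0) * fps_of_poly Q = gf (L j)"
    "Q' \<noteq> 0" "gf (L j) * fps_of_poly Q' = gf (L (Suc j))"
    using gf_step[of j] by auto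
  thus ?case by (intro exI[of _ "Q * Q'"]) (metis fps_of_poly_mult mult.assoc mult_eq_0_iff)
qed

private lemma gf_L_n: "\<exists>P. gf (L n) = fps_of_poly P"
proof -
  define M where "M = Max (insert 0 ((\<lambda>x. nat (\<Sum>i=1..n. x i)) ` L n))"
  have "gf (L n) $ m = 0" if "m > M" for m
  proof -
    have "{x \<in> L n. (\<Sum>i=1..n. x i) = int m} = {}"
    proof safe
      fix x assume x: "x \<in> L n" "(\<Sum>i=1..n. x i) = int m"
      have "nat (\<Sum>i=1..n. x i) \<le> M"
        unfolding M_def using x(1) finite_L_n by (intro Max_ge) auto
      thus "x \<in> {}" using x(2) that by simp
    qed
    thus ?thesis by (simp only: gf_def fps_nth_Abs_fps card.empty of_nat_0)
  qed
  hence "gf (L n) = fps_of_poly (Abs_poly (\<lambda>m. gf (L n) $ m))"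
    by (intro fps_ext) (simp add: coeff_Abs_poly[of M])
  thus ?thesis by blast
qed

theorem lecture_hall_fps_rational:
  "\<exists>!r. ratfun_expansion r (lecture_hall_fps s n)"
proof -
  have F: "lecture_hall_fps s n = gf (L 0)"
    by (simp add: lecture_hall_fps_def gf_def L_0)
  obtain Q P where "Q \<noteq> 0" "gf (L 0) * fps_of_poly Q = fps_of_poly P"
    using gf_steps[of n] gf_L_n by auto
  hence "ratfun_expansion (Fract P Q) (lecture_hall_fps s n)"
    unfolding F by (simp add: ratfun_expansion_Fract_iff)
  thus ?thesis using ratfun_expansion_unique by blast
qed

corollary lecture_hall_gf_expansion:
  "ratfun_expansion (lecture_hall_gf s n) (lecture_hall_fps s n)"
  unfolding lecture_hall_gf_def ratfun_of_fps_def
  using lecture_hall_fps_rational by (rule theI')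

end

end

(*
  By reciprocity, f(1/q) is up to sign the generating function of the interior points of the
  lecture hall cone K, so f is self-reciprocal iff the interior is a translate c + K (compare the
  numbers of points of each degree).  The apex c then lies at height gcd(s_i, s_{i+1}) =: g_i above
  the i-th facet: c_{i+1} s_i - c_i s_{i+1} = g_i.  Reducing two consecutive relations modulo s_{i+1}
  and using the recurrence gives s_{i+1} | b g_i + g_{i+1}.  For b = -1 the point
  c_i = s_i + s_{i-1} works.  For b other than -1 the divisibility fails for some i: the number
  b g_i + g_{i+1} is at most 2|b| g_i in absolute value and does not vanish for two consecutive i,
  which would bound the numerators and denominators of infinitely many of the distinct fractions
  s_{i+1} / s_i.
*)
theory Submission
  imports Defs
begin

section \<open>Substituting the reciprocal\<close>

text \<open>Taken on arbitrary polynomials, where it is a ring homomorphism;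
  \<open>ratfun_subst\<close> is tied to the reduced fraction, which is awkward to compute.\<close>

definition ratfun_eval_inverse :: "rat poly \<Rightarrow> rat poly fract" where
  "ratfun_eval_inverse p = poly (map_poly (\<lambda>c. to_fract [:c:]) p) (1 / ratfun_q)"

lemma ratfun_eval_inverse_pCons:
  "ratfun_eval_inverse (pCons c p) = to_fract [:c:] + (1 / ratfun_q) * ratfun_eval_inverse p"
  unfolding ratfun_eval_inverse_def by (cases "pCons c p = 0") (auto simp: map_poly_pCons)

lemma ratfun_eval_inverse_0 [simp]: "ratfun_eval_inverse 0 = 0"
  by (simp add: ratfun_eval_inverse_def)

lemma ratfun_eval_inverse_add:
  "ratfun_eval_inverse (p + r) = ratfun_eval_inverse p + ratfun_eval_inverse r"
proof (induction p r rule: poly_induct2)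
  case (pCons a p b r)
  have "to_fract [:a + b:] = to_fract [:a:] + to_fract [:b:]"
    by (simp flip: to_fract_add)
  thus ?case using pCons by (simp add: ratfun_eval_inverse_pCons algebra_simps)
qed simp

lemma ratfun_eval_inverse_smult:
  "ratfun_eval_inverse (smult c p) = to_fract [:c:] * ratfun_eval_inverse p"
proof (induction p)
  case (pCons a p)
  have "to_fract [:c * a:] = to_fract [:c:] * to_fract [:a:]"
    by (simp flip: to_fract_mult)
  thus ?case using pCons by (simp add: ratfun_eval_inverse_pCons algebra_simps)
qed simp

lemma ratfun_eval_inverse_mult:
  "ratfun_eval_inverse (p * r) = ratfun_eval_inverse p * ratfun_eval_inverse r"
proof (induction p)
  case (pCons a p)
  have "ratfun_eval_inverse (pCons a p * r) =
        to_fract [:a:] * ratfun_eval_inverse r + ratfun_eval_inverse (pCons 0 (p * r))"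
    by (simp add: mult_pCons_left ratfun_eval_inverse_add ratfun_eval_inverse_smult)
  thus ?case using pCons by (simp add: ratfun_eval_inverse_pCons algebra_simps)
qed simp

lemma ratfun_eval_inverse_1 [simp]: "ratfun_eval_inverse 1 = 1"
  unfolding one_pCons ratfun_eval_inverse_pCons by (simp flip: one_pCons)

lemma ratfun_eval_inverse_sum:
  "ratfun_eval_inverse (\<Sum>x\<in>A. f x) = (\<Sum>x\<in>A. ratfun_eval_inverse (f x))"
  by (induction A rule: infinite_finite_induct) (auto simp: ratfun_eval_inverse_add)

lemma ratfun_eval_inverse_monom: "ratfun_eval_inverse (monom 1 d) = (1 / ratfun_q) ^ d"
  by (induction d) (simp_all add: monom_0 monom_Suc ratfun_eval_inverse_pCons flip: one_pCons)

lemma ratfun_eval_inverse_prod: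
  "ratfun_eval_inverse (\<Prod>x\<in>A. f x) = (\<Prod>x\<in>A. ratfun_eval_inverse (f x))"
  by (induction A rule: infinite_finite_induct) (auto simp: ratfun_eval_inverse_mult)

lemma ratfun_q_nonzero [simp]: "ratfun_q \<noteq> 0"
  by (simp add: ratfun_q_def)

lemma to_fract_monom: "to_fract (monom 1 d) = ratfun_q ^ d"
proof (induction d)
  case (Suc d)
  have "monom (1::rat) (Suc d) = [:0, 1:] * monom 1 d" by (simp add: monom_Suc)
  thus ?case using Suc by (simp only: to_fract_mult power_Suc ratfun_q_def)
qed (simp add: monom_0 flip: one_pCons)

lemma to_fract_sum: "to_fract (\<Sum>x\<in>A. f x) = (\<Sum>x\<in>A. to_fract (f x))"
  by (induction A rule: infinite_finite_induct) auto

lemma to_fract_prod: "to_fract (\<Prod>x\<in>A. f x) = (\<Prod>x\<in>A. to_fract (f x))"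
  by (induction A rule: infinite_finite_induct) auto

text \<open>The reduced fraction and \<open>Fract P Q\<close> are linked by a cross-multiplied
  polynomial identity, which a multiplicative substitution preserves. Hence any representation may
  be used to substitute.\<close>

lemma ratfun_subst_Fract:
  assumes "Q \<noteq> 0" "ratfun_eval_inverse Q \<noteq> 0"
  shows "ratfun_subst (Fract P Q) (1 / ratfun_q) = ratfun_eval_inverse P / ratfun_eval_inverse Q"
proof -
  define N D where "N = ratfun_num (Fract P Q)" and "D = ratfun_den (Fract P Q)"
  have D0: "D \<noteq> 0" unfolding D_def by simp
  have "Fract N D = Fract P Q" unfolding N_def D_def by simp
  hence "N * Q = P * D" using assms D0 by (simp add: eq_fract)
  hence "ratfun_eval_inverse N * ratfun_eval_inverse Q = ratfun_eval_inverse P * ratfun_eval_inverse D"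
    by (metis ratfun_eval_inverse_mult)
  moreover have "ratfun_eval_inverse D \<noteq> 0"
    unfolding D_def ratfun_eval_inverse_def by (rule ratfun_subst_reciprocal_den_nonzero)
  ultimately show ?thesis
    using assms unfolding ratfun_subst_def N_def[symmetric] D_def[symmetric]
      ratfun_eval_inverse_def[symmetric] by (simp add: field_simps)
qed

text \<open>Each factor contributes \<open>(1 - q^(-d)) * q^d = -(1 - q^d)\<close>.\<close>

lemma ratfun_eval_inverse_one_minus_prod:
  assumes "finite A"
  shows "ratfun_eval_inverse (\<Prod>i\<in>A. 1 - monom 1 (e i)) * ratfun_q ^ (\<Sum>i\<in>A. e i) =
           (- 1) ^ card A * to_fract (\<Prod>i\<in>A. 1 - monom 1 (e i))"
proof -
  have "ratfun_eval_inverse (1 - monom 1 d) * ratfun_q ^ d = - to_fract (1 - monom 1 d)" for d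
  proof -
    have "ratfun_eval_inverse (1 - monom 1 d) + ratfun_eval_inverse (monom 1 d) = 1"
      by (simp flip: ratfun_eval_inverse_add)
    hence "ratfun_eval_inverse (1 - monom 1 d) = 1 - (1 / ratfun_q) ^ d"
      by (simp add: ratfun_eval_inverse_monom algebra_simps)
    thus ?thesis by (simp add: to_fract_monom field_simps)
  qed
  hence "(\<Prod>i\<in>A. ratfun_eval_inverse (1 - monom 1 (e i)) * ratfun_q ^ e i) =
        (\<Prod>i\<in>A. - to_fract (1 - monom 1 (e i)))" by simp
  thus ?thesis
    using assms by (simp add: prod.distrib ratfun_eval_inverse_prod to_fract_prod power_sum
        prod_uminus del: to_fract_diff)
qed

lemma one_minus_prod_nonzero:
  assumes "finite A" "\<And>i. i \<in> A \<Longrightarrow> e i > 0"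
  shows "(\<Prod>i\<in>A. 1 - monom (1::rat) (e i)) \<noteq> 0"
proof -
  have "coeff (1 - monom (1::rat) d) 0 \<noteq> 0" if "d > 0" for d using that by simp
  hence "1 - monom (1::rat) d \<noteq> 0" if "d > 0" for d using that by (metis coeff_0)
  thus ?thesis using assms by (simp add: prod_zero_iff)
qed

text \<open>Multiplying numerator and denominator by \<open>q\<close> to the sum of the
  \<open>e i\<close> reproduces the denominator up to sign, so only \<open>P\<close> and
  \<open>R\<close> remain to be compared. The sign \<open>\<epsilon>\<close> merely swaps the two
  alternatives.\<close>

lemma self_reciprocal_Fract_iff:
  assumes "finite A" "\<And>i. i \<in> A \<Longrightarrow> e i > 0"
    and "ratfun_eval_inverse P * ratfun_q ^ (\<Sum>i\<in>A. e i) = to_fract R"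
  shows "self_reciprocal (Fract P (\<Prod>i\<in>A. 1 - monom 1 (e i))) \<longleftrightarrow>
           (\<exists>k. R = monom 1 k * P \<or> R = - (monom 1 k * P))"
proof -
  define Q where "Q = (\<Prod>i\<in>A. 1 - monom (1::rat) (e i))"
  define d where "d = (\<Sum>i\<in>A. e i)"
  define \<epsilon> :: "rat poly fract" where "\<epsilon> = (- 1) ^ card A"
  have \<epsilon>: "\<epsilon> = 1 \<or> \<epsilon> = - 1"
    unfolding \<epsilon>_def by (cases "even (card A)") auto
  have Q0: "Q \<noteq> 0" unfolding Q_def by (rule one_minus_prod_nonzero) fact+
  have Q: "ratfun_eval_inverse Q * ratfun_q ^ d = \<epsilon> * to_fract Q"
    unfolding Q_def d_def \<epsilon>_def by (rule ratfun_eval_inverse_one_minus_prod) fact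
  have eQ0: "ratfun_eval_inverse Q \<noteq> 0" using Q Q0 \<epsilon> by auto
  have "ratfun_subst (Fract P Q) (1 / ratfun_q) =
          (ratfun_eval_inverse P * ratfun_q ^ d) / (ratfun_eval_inverse Q * ratfun_q ^ d)"
    by (simp add: ratfun_subst_Fract Q0 eQ0)
  also have "\<dots> = \<epsilon> * to_fract R / to_fract Q"
    unfolding Q using assms(3) \<epsilon> by (auto simp: d_def)
  finally have subst: "ratfun_subst (Fract P Q) (1 / ratfun_q) = \<epsilon> * to_fract R / to_fract Q" .
  have r: "Fract P Q = to_fract P / to_fract Q"
    by (simp add: to_fract_def Q0)
  have mono: "ratfun_q ^ k * to_fract P = to_fract (monom 1 k * P)" for k
    by (simp add: to_fract_monom)
  have "\<epsilon> * to_fract R / to_fract Q = ratfun_q ^ k * Fract P Q \<longleftrightarrow>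
          \<epsilon> * to_fract R = to_fract (monom 1 k * P)"
       "\<epsilon> * to_fract R / to_fract Q = - (ratfun_q ^ k * Fract P Q) \<longleftrightarrow>
          \<epsilon> * to_fract R = - to_fract (monom 1 k * P)" for k
    unfolding r mono[symmetric] using Q0 by (auto simp: field_simps)
  moreover have "to_fract R = - to_fract p \<longleftrightarrow> R = - p" for p
    by (metis to_fract_eq_iff to_fract_uminus)
  ultimately show ?thesis
    unfolding self_reciprocal_def Q_def[symmetric] subst
    using \<epsilon> by (elim disjE) (simp_all del: to_fract_mult add: minus_equation_iff[of "to_fract R"]
        eq_commute[of _ "to_fract R"] disj_commute)
qed

text \<open>With numerator 1 the cleared numerator \<open>R\<close> is a power of \<open>q\<close>,
  so the shift \<open>k\<close> is the sum of the exponents.\<close>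

lemma self_reciprocal_inverse_one_minus_prod:
  assumes "finite A" "\<And>i. i \<in> A \<Longrightarrow> e i > 0"
  shows "self_reciprocal (inverse (\<Prod>i\<in>A. 1 - ratfun_q ^ e i))"
proof -
  have "inverse (\<Prod>i\<in>A. 1 - ratfun_q ^ e i) = inverse (to_fract (\<Prod>i\<in>A. 1 - monom 1 (e i)))"
    by (simp add: to_fract_prod to_fract_monom)
  also have "\<dots> = Fract 1 (\<Prod>i\<in>A. 1 - monom 1 (e i))"
    by (simp add: to_fract_def)
  finally show ?thesis
    using self_reciprocal_Fract_iff[OF assms, where P = 1 and R = "monom 1 (\<Sum>i\<in>A. e i)"]
    by (auto simp: to_fract_monom)
qed

section \<open>Reciprocity for the lecture hall cone\<close>

locale positive_sequence =
  fixes s :: "nat \<Rightarrow> int" and n :: nat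
  assumes s_pos: "\<And>i. i \<ge> 1 \<Longrightarrow> s i > 0"
begin

text \<open>The value 0 at index 0 makes the first coordinate equal to \<open>x 1 / s 1\<close>, so
  the first facet is treated like all others.\<close>

definition lh_ratio :: "(nat \<Rightarrow> int) \<Rightarrow> nat \<Rightarrow> rat" where
  "lh_ratio x i = (if i = 0 then 0 else of_int (x i) / of_int (s i))"

definition lh_coord :: "(nat \<Rightarrow> int) \<Rightarrow> nat \<Rightarrow> rat" where
  "lh_coord x i = lh_ratio x i - lh_ratio x (i - 1)"

definition lh_gen :: "nat \<Rightarrow> nat \<Rightarrow> int" where
  "lh_gen j i = (if i \<ge> j then s i else 0)"

definition lh_deg :: "(nat \<Rightarrow> int) \<Rightarrow> int" where
  "lh_deg x = (\<Sum>i=1..n. x i)"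

definition vec_add :: "(nat \<Rightarrow> int) \<Rightarrow> (nat \<Rightarrow> int) \<Rightarrow> nat \<Rightarrow> int" where
  "vec_add x y = (\<lambda>i\<in>{1..n}. x i + y i)"

definition vec_diff :: "(nat \<Rightarrow> int) \<Rightarrow> (nat \<Rightarrow> int) \<Rightarrow> nat \<Rightarrow> int" where
  "vec_diff x y = (\<lambda>i\<in>{1..n}. x i - y i)"

text \<open>
  The points with nonnegative (if \<open>strict\<close>, positive) coordinates along the generators,
  the first \<open>j\<close> of which lie in \<open>[0,1)\<close> (if \<open>strict\<close>, in \<open>(0,1]\<close>): \<open>j = 0\<close> is the cone
  (its interior), \<open>j = n\<close> a half-open fundamental parallelepiped.
\<close>

definition lh_slab :: "bool \<Rightarrow> nat \<Rightarrow> (nat \<Rightarrow> int) set" where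
  "lh_slab strict j = {x \<in> {1..n} \<rightarrow>\<^sub>E UNIV. \<forall>i\<in>{1..n}.
     (if strict then 0 < lh_coord x i else 0 \<le> lh_coord x i) \<and>
     (i \<le> j \<longrightarrow> (if strict then lh_coord x i \<le> 1 else lh_coord x i < 1))}"

definition lh_level :: "(nat \<Rightarrow> int) set \<Rightarrow> nat \<Rightarrow> (nat \<Rightarrow> int) set" where
  "lh_level A m = {x \<in> A. lh_deg x = int m}"

definition lh_series :: "(nat \<Rightarrow> int) set \<Rightarrow> rat fps" where
  "lh_series A = Abs_fps (\<lambda>m. of_nat (card (lh_level A m)))"

definition gen_deg :: "nat \<Rightarrow> nat" where
  "gen_deg j = nat (\<Sum>i=j..n. s i)"

section \<open>Vector arithmetic, degrees and coordinates\<close>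

lemma vec_add_in [simp]: "vec_add x y \<in> {1..n} \<rightarrow>\<^sub>E UNIV"
  and vec_diff_in [simp]: "vec_diff x y \<in> {1..n} \<rightarrow>\<^sub>E UNIV"
  by (auto simp: vec_add_def vec_diff_def)

lemma vec_add_diff: "x \<in> {1..n} \<rightarrow>\<^sub>E UNIV \<Longrightarrow> vec_add (vec_diff x y) y = x"
  and vec_diff_add: "x \<in> {1..n} \<rightarrow>\<^sub>E UNIV \<Longrightarrow> vec_diff (vec_add x y) y = x"
  and vec_diff_diff: "x \<in> {1..n} \<rightarrow>\<^sub>E UNIV \<Longrightarrow> vec_diff y (vec_diff y x) = x"
  by (auto simp: vec_add_def vec_diff_def fun_eq_iff PiE_def extensional_def)

lemma lh_deg_add: "lh_deg (vec_add x y) = lh_deg x + lh_deg y"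
  and lh_deg_diff: "lh_deg (vec_diff x y) = lh_deg x - lh_deg y"
  by (simp_all add: lh_deg_def vec_add_def vec_diff_def sum.distrib sum_subtractf)

lemma lh_ratio_add: "i \<le> n \<Longrightarrow> lh_ratio (vec_add x y) i = lh_ratio x i + lh_ratio y i"
  and lh_ratio_diff: "i \<le> n \<Longrightarrow> lh_ratio (vec_diff x y) i = lh_ratio x i - lh_ratio y i"
  by (auto simp: lh_ratio_def vec_add_def vec_diff_def add_divide_distrib diff_divide_distrib)

lemma lh_coord_add: "i \<in> {1..n} \<Longrightarrow> lh_coord (vec_add x y) i = lh_coord x i + lh_coord y i"
  and lh_coord_diff: "i \<in> {1..n} \<Longrightarrow> lh_coord (vec_diff x y) i = lh_coord x i - lh_coord y i"
  unfolding lh_coord_def by (simp_all add: lh_ratio_add lh_ratio_diff le_diff_conv)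

lemma lh_coord_gen:
  assumes "i \<ge> 1" "j \<ge> 1"
  shows "lh_coord (lh_gen j) i = (if i = j then 1 else 0)"
proof -
  have "lh_ratio (lh_gen j) k = (if k \<ge> j then 1 else 0)" for k
    using s_pos[of k] assms(2) by (auto simp: lh_ratio_def lh_gen_def)
  thus ?thesis using assms unfolding lh_coord_def by auto
qed

lemma lh_deg_gen:
  assumes "j \<in> {1..n}"
  shows "lh_deg (lh_gen j) = int (gen_deg j)" and "gen_deg j > 0"
proof -
  have pos: "(\<Sum>i=j..n. s i) > 0"
    using assms s_pos by (intro sum_pos) auto
  have "lh_deg (lh_gen j) = (\<Sum>i=j..n. s i)"
    unfolding lh_deg_def lh_gen_def using assms by (intro sum.mono_neutral_cong_right) auto
  with pos show "lh_deg (lh_gen j) = int (gen_deg j)" "gen_deg j > 0"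
    unfolding gen_deg_def by auto
qed

lemma lh_ratio_eq_sum: "i \<le> n \<Longrightarrow> lh_ratio x i = (\<Sum>k=1..i. lh_coord x k)"
  by (induction i) (auto simp: lh_coord_def lh_ratio_def)

lemma lh_slab_ext: "x \<in> lh_slab t j \<Longrightarrow> x \<in> {1..n} \<rightarrow>\<^sub>E UNIV"
  unfolding lh_slab_def by auto

lemma lh_coord_nonneg: "x \<in> lh_slab t j \<Longrightarrow> i \<in> {1..n} \<Longrightarrow> 0 \<le> lh_coord x i"
  unfolding lh_slab_def by (cases t) (auto simp: less_imp_le)

lemma lh_slab_nonneg:
  assumes "x \<in> lh_slab t j" "i \<in> {1..n}"
  shows "0 \<le> x i"
proof -
  have "0 \<le> lh_ratio x i"
    using assms(2) lh_coord_nonneg[OF assms(1)] by (subst lh_ratio_eq_sum) (auto intro!: sum_nonneg)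
  thus ?thesis using assms(2) s_pos[of i] by (auto simp: lh_ratio_def zero_le_divide_iff)
qed

lemma lh_deg_nonneg: "x \<in> lh_slab t j \<Longrightarrow> 0 \<le> lh_deg x"
  unfolding lh_deg_def by (intro sum_nonneg lh_slab_nonneg)

section \<open>Splitting off one generator at a time\<close>

lemma finite_lh_level: "finite (lh_level (lh_slab t j) m)"
proof (rule finite_subset)
  show "lh_level (lh_slab t j) m \<subseteq> {1..n} \<rightarrow>\<^sub>E {0..int m}"
  proof
    fix x assume "x \<in> lh_level (lh_slab t j) m"
    hence x: "x \<in> lh_slab t j" "lh_deg x = int m" by (auto simp: lh_level_def)
    have "x i \<in> {0..int m}" if "i \<in> {1..n}" for i
    proof -
      have "x i \<le> lh_deg x"
        unfolding lh_deg_def using that lh_slab_nonneg[OF x(1)] by (intro member_le_sum) auto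
      thus ?thesis using x(2) lh_slab_nonneg[OF x(1) that] by auto
    qed
    thus "x \<in> {1..n} \<rightarrow>\<^sub>E {0..int m}" using lh_slab_ext[OF x(1)] by (auto simp: PiE_def)
  qed
qed (intro finite_PiE; simp)

text \<open>Adding a generator raises exactly one coordinate by 1. Thus the points of a slab that
  miss the next slab are the translates of the whole slab by that generator, for half-open intervals
  of either kind.\<close>

lemma lh_slab_Suc:
  assumes "j < n"
  shows "lh_slab t (Suc j) \<subseteq> lh_slab t j"
    and "x \<in> lh_slab t j \<Longrightarrow> vec_add x (lh_gen (Suc j)) \<in> lh_slab t j - lh_slab t (Suc j)"
    and "x \<in> lh_slab t j - lh_slab t (Suc j) \<Longrightarrow> vec_diff x (lh_gen (Suc j)) \<in> lh_slab t j"
proof -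
  have j: "Suc j \<in> {1..n}" using assms by auto
  show "lh_slab t (Suc j) \<subseteq> lh_slab t j" unfolding lh_slab_def by auto
  show "vec_add x (lh_gen (Suc j)) \<in> lh_slab t j - lh_slab t (Suc j)" if "x \<in> lh_slab t j"
  proof
    show "vec_add x (lh_gen (Suc j)) \<in> lh_slab t j"
      using that unfolding lh_slab_def
      by (cases t) (simp_all add: lh_coord_add lh_coord_gen del: One_nat_def, force+)
    have "0 \<le> lh_coord x (Suc j)" by (rule lh_coord_nonneg[OF that j])
    moreover have "t \<longrightarrow> 0 < lh_coord x (Suc j)"
      using that j unfolding lh_slab_def by auto
    ultimately show "vec_add x (lh_gen (Suc j)) \<notin> lh_slab t (Suc j)"
      unfolding lh_slab_def using j by (auto simp: lh_coord_add lh_coord_gen intro!: bexI[of _ "Suc j"])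
  qed
  show "vec_diff x (lh_gen (Suc j)) \<in> lh_slab t j" if x: "x \<in> lh_slab t j - lh_slab t (Suc j)"
  proof -
    have "if t then 1 < lh_coord x (Suc j) else 1 \<le> lh_coord x (Suc j)"
      using x j unfolding lh_slab_def by (auto simp: le_Suc_eq not_le not_less)
    thus ?thesis
      using x unfolding lh_slab_def
      by (cases t) (simp_all add: lh_coord_diff lh_coord_gen del: One_nat_def)
  qed
qed

text \<open>The decomposition of the slab reads \<open>F = F' + q^D * F\<close>, where
  \<open>D\<close> is the degree of the generator; solving for \<open>F'\<close> gives the factor
  \<open>1 - q^D\<close>.\<close>

lemma lh_series_step:
  assumes "j < n"
  shows "lh_series (lh_slab t j) * fps_of_poly (1 - monom 1 (gen_deg (Suc j))) =
           lh_series (lh_slab t (Suc j))"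
proof -
  define D where "D = gen_deg (Suc j)"
  define g where "g = lh_gen (Suc j)"
  have g: "lh_deg g = int D"
    using lh_deg_gen[of "Suc j"] assms unfolding g_def D_def by simp
  note slab = lh_slab_Suc[OF assms, folded g_def]
  define H where "H = lh_level (lh_slab t j)"
  define K where "K = lh_level (lh_slab t (Suc j))"
  define G where "G = lh_level (lh_slab t j - lh_slab t (Suc j))"
  have card_H: "card (H m) = card (K m) + card (G m)" for m
  proof -
    have "H m = K m \<union> G m" "K m \<inter> G m = {}"
      using slab(1) unfolding H_def K_def G_def lh_level_def by auto
    moreover have "finite (H m)" unfolding H_def by (rule finite_lh_level)
    ultimately show ?thesis by (simp add: card_Un_disjoint)
  qed
  have card_G: "card (G m) = (if m < D then 0 else card (H (m - D)))" for m
  proof (cases "m < D")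
    case True
    \<comment> \<open>Removing the generator would leave a slab point of negative degree.\<close>
    have "x \<notin> G m" for x
      using lh_deg_nonneg[OF slab(3)[of x t]] True lh_deg_diff[of x g] g
      unfolding G_def lh_level_def by auto
    hence "G m = {}" by blast
    thus ?thesis using True by simp
  next
    case False
    have "bij_betw (\<lambda>x. vec_add x g) (H (m - D)) (G m)"
      by (rule bij_betwI[where g = "\<lambda>x. vec_diff x g"])
         (use False slab g in \<open>auto simp: H_def G_def lh_level_def lh_deg_add lh_deg_diff of_nat_diff
            intro!: vec_add_diff vec_diff_add lh_slab_ext\<close>)
    thus ?thesis using False by (simp add: bij_betw_same_card)
  qed
  have "lh_series (lh_slab t j) = lh_series (lh_slab t (Suc j)) + fps_X ^ D * lh_series (lh_slab t j)"
  proof (rule fps_ext)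
    fix m
    have "lh_series (lh_slab t j) $ k = of_nat (card (H k))"
         "lh_series (lh_slab t (Suc j)) $ k = of_nat (card (K k))" for k
      unfolding lh_series_def H_def K_def by (rule fps_nth_Abs_fps)+
    thus "lh_series (lh_slab t j) $ m =
            (lh_series (lh_slab t (Suc j)) + fps_X ^ D * lh_series (lh_slab t j)) $ m"
      using card_H[of m] card_G[of m] by (simp add: fps_X_power_mult_nth)
  qed
  thus ?thesis
    unfolding D_def by (simp add: fps_of_poly_diff fps_of_poly_monom' algebra_simps)
qed

lemma lh_series_steps:
  "j \<le> n \<Longrightarrow> lh_series (lh_slab t 0) * fps_of_poly (\<Prod>i=1..j. 1 - monom 1 (gen_deg i)) =
     lh_series (lh_slab t j)"
proof (induction j)
  case (Suc j)
  have "(\<Prod>i=1..Suc j. 1 - monom (1::rat) (gen_deg i)) =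
        (\<Prod>i=1..j. 1 - monom 1 (gen_deg i)) * (1 - monom 1 (gen_deg (Suc j)))"
    by simp
  thus ?case
    using Suc lh_series_step[of j t] by (simp only: fps_of_poly_mult mult.assoc[symmetric] Suc_le_eq less_imp_le)
qed simp

section \<open>Reflection of the fundamental parallelepiped\<close>

definition lh_top :: "nat \<Rightarrow> int" where
  "lh_top = (\<lambda>i\<in>{1..n}. int i * s i)"

lemma lh_coord_top: "i \<in> {1..n} \<Longrightarrow> lh_coord lh_top i = 1"
  using s_pos[of i] s_pos[of "i - 1"]
  by (cases "i = 1") (auto simp: lh_coord_def lh_ratio_def lh_top_def of_nat_diff)

text \<open>\<open>lh_top\<close> is the sum of all generators, since exactly the first
  \<open>i\<close> of them contribute \<open>s i\<close> to entry \<open>i\<close>. Its degree is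
  therefore the exponent that clears the denominator under \<open>q\<close> to
  \<open>1/q\<close>.\<close>

lemma lh_deg_top: "lh_deg lh_top = int (\<Sum>i=1..n. gen_deg i)"
proof -
  have "int (\<Sum>i=1..n. gen_deg i) = (\<Sum>j=1..n. lh_deg (lh_gen j))"
    unfolding of_nat_sum by (intro sum.cong refl lh_deg_gen(1)[symmetric])
  also have "\<dots> = (\<Sum>i=1..n. \<Sum>j=1..n. lh_gen j i)"
    unfolding lh_deg_def by (rule sum.swap)
  also have "\<dots> = (\<Sum>i=1..n. lh_top i)"
  proof (rule sum.cong [OF refl])
    fix i assume i: "i \<in> {1..n}"
    have "(\<Sum>j=1..n. lh_gen j i) = (\<Sum>j=1..i. s i)"
      unfolding lh_gen_def using i by (intro sum.mono_neutral_cong_right) auto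
    thus "(\<Sum>j=1..n. lh_gen j i) = lh_top i" using i by (simp add: lh_top_def)
  qed
  finally show ?thesis by (simp add: lh_deg_def)
qed

text \<open>Every coordinate of \<open>lh_top\<close> is 1, so a coordinate \<open>a\<close> becomes
  \<open>1 - a\<close>, which exchanges \<open>[0,1)\<close> and \<open>(0,1]\<close>.\<close>

lemma bij_betw_reflect: "bij_betw (vec_diff lh_top) (lh_slab False n) (lh_slab True n)"
  by (rule bij_betwI[where g = "vec_diff lh_top"])
     (auto simp: lh_slab_def lh_coord_diff lh_coord_top simp del: One_nat_def intro!: vec_diff_diff)

lemma lh_deg_le_top: "x \<in> lh_slab False n \<Longrightarrow> lh_deg x \<le> lh_deg lh_top"
  using lh_deg_nonneg[of "vec_diff lh_top x" True n] bij_betw_reflect lh_deg_diff[of lh_top x]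
  by (auto dest: bij_betwE)

lemma finite_lh_slab: "finite (lh_slab t n)"
proof -
  have "lh_slab False n \<subseteq> (\<Union>m\<le>nat (lh_deg lh_top). lh_level (lh_slab False n) m)"
  proof
    fix x assume "x \<in> lh_slab False n"
    thus "x \<in> (\<Union>m\<le>nat (lh_deg lh_top). lh_level (lh_slab False n) m)"
      using lh_deg_le_top[of x] lh_deg_nonneg[of x False n]
      by (intro UN_I[of "nat (lh_deg x)"]) (auto simp: lh_level_def)
  qed
  hence "finite (lh_slab False n)"
    by (rule finite_subset) (simp add: finite_lh_level)
  thus ?thesis using bij_betw_finite[OF bij_betw_reflect] by (cases t) auto
qed

lemma lh_series_slab_n:
  "lh_series (lh_slab t n) = fps_of_poly (\<Sum>x\<in>lh_slab t n. monom 1 (nat (lh_deg x)))"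
proof (rule fps_ext)
  fix m
  have "(\<Sum>x\<in>lh_slab t n. if nat (lh_deg x) = m then 1 else 0) =
        (rat_of_nat (card {x \<in> lh_slab t n. nat (lh_deg x) = m}))"
    using finite_lh_slab by (simp add: sum.If_cases Int_def)
  also have "{x \<in> lh_slab t n. nat (lh_deg x) = m} = lh_level (lh_slab t n) m"
    using lh_deg_nonneg by (force simp: lh_level_def)
  finally show "lh_series (lh_slab t n) $ m =
      fps_of_poly (\<Sum>x\<in>lh_slab t n. monom 1 (nat (lh_deg x))) $ m"
    by (simp add: lh_series_def coeff_sum)
qed

section \<open>The cone and its interior through integer inequalities\<close>

lemma lh_coord_1: "lh_coord x 1 = of_int (x 1) / of_int (s 1)"
  by (simp add: lh_coord_def lh_ratio_def)

lemma lh_coord_Suc: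
  assumes "i \<ge> 1"
  shows "lh_coord x (i + 1) = of_int (x (i + 1) * s i - x i * s (i + 1)) / of_int (s i * s (i + 1))"
  using assms s_pos[of i] s_pos[of "i + 1"] by (simp add: lh_coord_def lh_ratio_def field_simps)

text \<open>Coordinates are rescaled by positive denominators. The resulting integer determinants
  measure the height of a point above each facet, which makes divisibility arguments
  possible.\<close>

lemma lh_slab_0_iff:
  "x \<in> lh_slab t 0 \<longleftrightarrow> x \<in> {1..n} \<rightarrow>\<^sub>E UNIV \<and>
     (n \<ge> 1 \<longrightarrow> (if t then 0 < x 1 else 0 \<le> x 1)) \<and>
     (\<forall>i\<in>{1..<n}. if t then 0 < x (i + 1) * s i - x i * s (i + 1)
                  else 0 \<le> x (i + 1) * s i - x i * s (i + 1))"
proof -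
  have 1: "0 < lh_coord x 1 \<longleftrightarrow> 0 < x 1" "0 \<le> lh_coord x 1 \<longleftrightarrow> 0 \<le> x 1"
    using s_pos[of 1] unfolding lh_coord_1 by (simp_all add: zero_less_divide_iff zero_le_divide_iff)
  have 2: "0 < lh_coord x (i + 1) \<longleftrightarrow> 0 < x (i + 1) * s i - x i * s (i + 1)"
    "0 \<le> lh_coord x (i + 1) \<longleftrightarrow> 0 \<le> x (i + 1) * s i - x i * s (i + 1)" if "i \<in> {1..<n}" for i
  proof -
    have "0 < rat_of_int a / of_int d \<longleftrightarrow> 0 < a" "0 \<le> rat_of_int a / of_int d \<longleftrightarrow> 0 \<le> a"
      if "d > 0" for a d using that by (simp_all add: zero_less_divide_iff zero_le_divide_iff)
    moreover have "0 < s i * s (i + 1)" "i \<ge> 1" using that s_pos[of i] s_pos[of "i + 1"] by simp_all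
    ultimately show "0 < lh_coord x (i + 1) \<longleftrightarrow> 0 < x (i + 1) * s i - x i * s (i + 1)"
      "0 \<le> lh_coord x (i + 1) \<longleftrightarrow> 0 \<le> x (i + 1) * s i - x i * s (i + 1)"
      unfolding lh_coord_Suc[OF \<open>i \<ge> 1\<close>] by blast+
  qed
  have split: "(\<forall>i\<in>{1..n}. Q i) \<longleftrightarrow> (n \<ge> 1 \<longrightarrow> Q 1) \<and> (\<forall>i\<in>{1..<n}. Q (i + 1))" for Q
  proof -
    have "{1..n} = (if n \<ge> 1 then {1} else {}) \<union> (\<lambda>i. i + 1) ` {1..<n}"
      by (auto simp: image_iff)
    thus ?thesis by (simp only: ball_Un ball_simps) simp
  qed
  show ?thesis
    unfolding lh_slab_def mem_Collect_eq split using 1 2 by auto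
qed

lemma lh_slab_closed_cone: "lh_slab False 0 = lecture_hall_partitions s n"
proof -
  have "rat_of_int a / of_int (s i) \<le> rat_of_int b / of_int (s (i + 1)) \<longleftrightarrow>
          0 \<le> b * s i - a * s (i + 1)" if "i \<ge> 1" for a b i
  proof -
    have "rat_of_int a / of_int (s i) \<le> rat_of_int b / of_int (s (i + 1)) \<longleftrightarrow>
            rat_of_int (a * s (i + 1)) \<le> rat_of_int (b * s i)"
      using that s_pos[of i] s_pos[of "i + 1"] by (simp add: field_simps)
    thus ?thesis unfolding of_int_le_iff by linarith
  qed
  moreover have "0 \<le> rat_of_int a / of_int (s 1) \<longleftrightarrow> 0 \<le> a" for a
    using s_pos[of 1] by (simp add: zero_le_divide_iff)
  ultimately show ?thesis
    unfolding lecture_hall_partitions_def set_eq_iff lh_slab_0_iff mem_Collect_eq by simp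
qed

lemma lecture_hall_fps_eq: "lecture_hall_fps s n = lh_series (lh_slab False 0)"
  unfolding lecture_hall_fps_def lh_series_def lh_level_def lh_deg_def lh_slab_closed_cone ..

text \<open>
  Reflecting the half-open parallelepiped in its centre identifies \<open>f(1/q)\<close>, up to sign, with
  the generating function of the interior of the cone.
\<close>

theorem self_reciprocal_iff_interior:
  "self_reciprocal (lecture_hall_gf s n) \<longleftrightarrow>
     (\<exists>k. lh_series (lh_slab True 0) = fps_X ^ k * lh_series (lh_slab False 0))"
proof -
  define P where "P t = (\<Sum>x\<in>lh_slab t n. monom (1::rat) (nat (lh_deg x)))" for t
  define Q where "Q = (\<Prod>i\<in>{1..n}. 1 - monom (1::rat) (gen_deg i))"
  define N where "N = (\<Sum>i\<in>{1..n}. gen_deg i)"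
  have pos: "gen_deg i > 0" if "i \<in> {1..n}" for i using lh_deg_gen(2)[OF that] .
  have Q0: "Q \<noteq> 0" unfolding Q_def using pos by (intro one_minus_prod_nonzero) auto
  have PQ: "lh_series (lh_slab t 0) * fps_of_poly Q = fps_of_poly (P t)" for t
    using lh_series_steps[of n t] lh_series_slab_n[of t] by (simp add: P_def Q_def)
  have gf: "lecture_hall_gf s n = Fract (P False) Q"
    unfolding lecture_hall_gf_def lecture_hall_fps_eq
    by (intro ratfun_of_fps_eqI) (simp add: ratfun_expansion_Fract_iff Q0 PQ)
  \<comment> \<open>The exponent \<open>N - deg x\<close> is the degree of the reflected point
    \<open>lh_top - x\<close>, so reindexing along the reflection yields the other
    numerator.\<close>
  have "ratfun_eval_inverse (P False) * ratfun_q ^ N = to_fract (P True)"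
  proof -
    have "ratfun_eval_inverse (P False) * ratfun_q ^ N =
            (\<Sum>x\<in>lh_slab False n. ratfun_q ^ nat (lh_deg (vec_diff lh_top x)))"
      unfolding P_def ratfun_eval_inverse_sum ratfun_eval_inverse_monom sum_distrib_right
    proof (rule sum.cong [OF refl])
      fix x assume x: "x \<in> lh_slab False n"
      have "nat (lh_deg (vec_diff lh_top x)) = N - nat (lh_deg x)" "nat (lh_deg x) \<le> N"
        using lh_deg_le_top[OF x] lh_deg_nonneg[OF x] lh_deg_top
        by (auto simp: lh_deg_diff N_def nat_diff_distrib simp del: of_nat_sum)
      thus "(1 / ratfun_q) ^ nat (lh_deg x) * ratfun_q ^ N =
              ratfun_q ^ nat (lh_deg (vec_diff lh_top x))"
        by (simp add: power_diff field_simps)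
    qed
    also have "\<dots> = (\<Sum>x\<in>lh_slab True n. ratfun_q ^ nat (lh_deg x))"
      by (rule sum.reindex_bij_betw[OF bij_betw_reflect])
    finally show ?thesis by (simp add: P_def to_fract_sum to_fract_monom)
  qed
  hence "self_reciprocal (lecture_hall_gf s n) \<longleftrightarrow>
           (\<exists>k. P True = monom 1 k * P False \<or> P True = - (monom 1 k * P False))"
    unfolding gf Q_def N_def using pos by (intro self_reciprocal_Fract_iff) auto
  \<comment> \<open>A minus sign is impossible: both numerators have nonnegative coefficients, and
    the origin gives \<open>P False\<close> a positive constant term.\<close>
  moreover have "P True \<noteq> - (monom 1 k * P False)" for k
  proof
    assume eq: "P True = - (monom 1 k * P False)"
    have coeff_nonneg: "coeff (P t) m \<ge> 0" for t m
      unfolding P_def by (auto simp: coeff_sum intro!: sum_nonneg)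
    have "P False = 0"
    proof (rule poly_eqI)
      fix m
      have "coeff (P True) (m + k) = - coeff (P False) m"
        unfolding eq by (simp add: coeff_monom_mult)
      thus "coeff (P False) m = coeff 0 m"
        using coeff_nonneg[of True "m + k"] coeff_nonneg[of False m] by simp
    qed
    moreover have "coeff (P False) 0 > 0"
    proof -
      let ?z = "\<lambda>i\<in>{1..n}. 0::int"
      have "?z \<in> lh_slab False n"
        unfolding lh_slab_def by (auto simp: lh_coord_def lh_ratio_def)
      moreover have "lh_deg ?z = 0" by (simp add: lh_deg_def)
      ultimately show ?thesis
        unfolding P_def coeff_sum using finite_lh_slab
        by (intro sum_pos2[of _ ?z]) auto
    qed
    ultimately show False by simp
  qed
  moreover have "P True = monom 1 k * P False \<longleftrightarrow>
      lh_series (lh_slab True 0) = fps_X ^ k * lh_series (lh_slab False 0)" for k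
  proof -
    have "P True = monom 1 k * P False \<longleftrightarrow> fps_of_poly (P True) = fps_X ^ k * fps_of_poly (P False)"
      by (metis fps_of_poly_eq_iff fps_of_poly_mult fps_of_poly_monom')
    also have "\<dots> \<longleftrightarrow> lh_series (lh_slab True 0) * fps_of_poly Q =
                      fps_X ^ k * lh_series (lh_slab False 0) * fps_of_poly Q"
      by (simp add: PQ mult.assoc)
    also have "fps_of_poly Q \<noteq> 0" using Q0 by (metis fps_of_poly_0 fps_of_poly_eq_iff)
    hence "lh_series (lh_slab True 0) * fps_of_poly Q =
             fps_X ^ k * lh_series (lh_slab False 0) * fps_of_poly Q \<longleftrightarrow>
           lh_series (lh_slab True 0) = fps_X ^ k * lh_series (lh_slab False 0)"
      by (rule mult_right_cancel)
    finally show ?thesis .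
  qed
  ultimately show ?thesis by blast
qed

section \<open>The interior as a translate of the cone\<close>

lemma vec_add_interior:
  "x \<in> lh_slab False 0 \<Longrightarrow> c \<in> lh_slab True 0 \<Longrightarrow> vec_add x c \<in> lh_slab True 0"
  unfolding lh_slab_def by (auto simp: lh_coord_add add_nonneg_pos simp del: One_nat_def)

lemma lh_series_nth: "lh_series A $ m = of_nat (card (lh_level A m))"
  by (simp add: lh_series_def)

text \<open>Translation by an interior point \<open>c\<close> always injects the cone into its
  interior, raising degrees by that of \<open>c\<close>. It is onto exactly when the levels have
  matching finite cardinalities, which is the identity of series with \<open>k\<close> the degree of
  \<open>c\<close>.\<close>

theorem self_reciprocal_iff_translate:
  "self_reciprocal (lecture_hall_gf s n) \<longleftrightarrow>
     (\<exists>c\<in>lh_slab True 0. \<forall>y\<in>lh_slab True 0. vec_diff y c \<in> lh_slab False 0)"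
proof -
  let ?C = "lh_slab False 0" and ?T = "lh_slab True 0"
  have into: "(\<lambda>x. vec_add x c) ` lh_level ?C m \<subseteq> lh_level ?T (m + nat (lh_deg c))"
    and inj: "inj_on (\<lambda>x. vec_add x c) (lh_level ?C m)" if c: "c \<in> ?T" for c m
  proof -
    show "(\<lambda>x. vec_add x c) ` lh_level ?C m \<subseteq> lh_level ?T (m + nat (lh_deg c))"
      using c lh_deg_nonneg[OF c] by (auto simp: lh_level_def lh_deg_add vec_add_interior)
    show "inj_on (\<lambda>x. vec_add x c) (lh_level ?C m)"
      by (rule inj_on_inverseI[where g = "\<lambda>x. vec_diff x c"])
         (auto simp: lh_level_def intro!: vec_diff_add lh_slab_ext)
  qed
  show ?thesis unfolding self_reciprocal_iff_interior
  proof
    assume "\<exists>k. lh_series ?T = fps_X ^ k * lh_series ?C"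
    then obtain k where k: "lh_series ?T = fps_X ^ k * lh_series ?C" by blast
    have card: "card (lh_level ?T m) = (if m < k then 0 else card (lh_level ?C (m - k)))" for m
    proof -
      have "lh_series ?T $ m = (if m < k then 0 else lh_series ?C $ (m - k))"
        unfolding k by (simp add: fps_X_power_mult_nth)
      thus ?thesis unfolding lh_series_nth by (auto split: if_splits)
    qed
    \<comment> \<open>The origin makes level 0 of the cone nonempty, hence also level
      \<open>k\<close> of the interior; the apex \<open>c\<close> is taken there.\<close>
    have "(\<lambda>i\<in>{1..n}. 0) \<in> lh_level ?C 0"
      by (auto simp: lh_level_def lh_slab_def lh_deg_def lh_coord_def lh_ratio_def)
    hence "card (lh_level ?T k) \<noteq> 0"
      unfolding card using finite_lh_level[of False 0 0] by (auto simp: card_eq_0_iff)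
    then obtain c where "c \<in> lh_level ?T k" by (metis card.empty equals0I)
    hence c: "c \<in> ?T" "lh_deg c = int k" by (auto simp: lh_level_def)
    show "\<exists>c\<in>?T. \<forall>y\<in>?T. vec_diff y c \<in> ?C"
    proof (intro bexI[of _ c] ballI)
      fix y assume y: "y \<in> ?T"
      define m where "m = nat (lh_deg y)"
      have ym: "y \<in> lh_level ?T m"
        using y lh_deg_nonneg[OF y] by (simp add: lh_level_def m_def)
      hence "card (lh_level ?T m) \<noteq> 0"
        using finite_lh_level[of True 0 m] by (auto simp: card_eq_0_iff)
      hence "k \<le> m" and "card (lh_level ?T m) = card (lh_level ?C (m - k))"
        using card[of m] by (auto split: if_splits)
      moreover have "m - k + nat (lh_deg c) = m" using \<open>k \<le> m\<close> c(2) by simp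
      \<comment> \<open>An injection between finite sets of equal size is onto.\<close>
      ultimately have "(\<lambda>x. vec_add x c) ` lh_level ?C (m - k) = lh_level ?T m"
        using into[OF c(1), of "m - k"] card_image[OF inj[OF c(1), of "m - k"]]
          finite_lh_level[of True 0 m] by (intro card_subset_eq) auto
      then obtain x where "x \<in> ?C" "y = vec_add x c"
        using ym by (auto simp: lh_level_def)
      thus "vec_diff y c \<in> ?C" using vec_diff_add[OF lh_slab_ext[of x]] by simp
    qed (fact c)
  next
    assume "\<exists>c\<in>?T. \<forall>y\<in>?T. vec_diff y c \<in> ?C"
    then obtain c where c: "c \<in> ?T" "\<And>y. y \<in> ?T \<Longrightarrow> vec_diff y c \<in> ?C" by blast
    define k where "k = nat (lh_deg c)"
    have k: "lh_deg c = int k" using lh_deg_nonneg[OF c(1)] by (simp add: k_def)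
    have "lh_series ?T $ m = (fps_X ^ k * lh_series ?C) $ m" for m
    proof (cases "m < k")
      case True
      have "lh_level ?T m = {}"
      proof safe
        fix y assume "y \<in> lh_level ?T m"
        hence "y \<in> ?T" "lh_deg y = int m" by (auto simp: lh_level_def)
        thus "y \<in> {}" using lh_deg_nonneg[OF c(2)[of y]] True k by (simp add: lh_deg_diff)
      qed
      thus ?thesis using True by (simp add: lh_series_nth fps_X_power_mult_nth)
    next
      case False
      have "lh_level ?T m \<subseteq> (\<lambda>x. vec_add x c) ` lh_level ?C (m - k)"
      proof
        fix y assume "y \<in> lh_level ?T m"
        hence "y \<in> ?T" "lh_deg y = int m" by (auto simp: lh_level_def)
        hence "vec_diff y c \<in> lh_level ?C (m - k)" "y = vec_add (vec_diff y c) c"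
          using c(2)[of y] False k vec_add_diff[OF lh_slab_ext[of y]]
          by (auto simp: lh_level_def lh_deg_diff of_nat_diff)
        thus "y \<in> (\<lambda>x. vec_add x c) ` lh_level ?C (m - k)" by blast
      qed
      hence "(\<lambda>x. vec_add x c) ` lh_level ?C (m - k) = lh_level ?T m"
        using into[OF c(1), of "m - k"] False by (auto simp flip: k_def)
      hence "card (lh_level ?T m) = card (lh_level ?C (m - k))"
        using card_image[OF inj[OF c(1), of "m - k"]] by simp
      thus ?thesis using False by (simp add: lh_series_nth fps_X_power_mult_nth)
    qed
    thus "\<exists>k. lh_series ?T = fps_X ^ k * lh_series ?C" by (auto intro!: fps_ext)
  qed
qed

text \<open>
  Some interior point lies at the least possible height \<open>gcd\<close> above a given facet, and since it
  lies in the translated cone, so does the apex.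
\<close>

lemma translate_facet_gcd:
  assumes c: "c \<in> lh_slab True 0" and "\<And>y. y \<in> lh_slab True 0 \<Longrightarrow> vec_diff y c \<in> lh_slab False 0"
    and i: "i \<in> {1..<n}"
  shows "c (i + 1) * s i - c i * s (i + 1) = gcd (s i) (s (i + 1))"
proof -
  define g where "g = gcd (s i) (s (i + 1))"
  obtain u v' where "u * s i + v' * s (i + 1) = g"
    using bezout_int[of "s i" "s (i + 1)"] unfolding g_def by blast
  then obtain v where uv: "u * s i - v * s (i + 1) = g"
    by (metis diff_minus_eq_add minus_mult_left)
  have s: "s i > 0" "s (i + 1) > 0" using i s_pos by auto
  have g: "g > 0" using s by (simp add: g_def)
  \<comment> \<open>The Bezout pair has the right height but may lie outside the cone. Adding
    \<open>t\<close> times the pair \<open>(s i, s (i + 1))\<close> keeps the height and lifts the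
    ratio at \<open>i\<close> to at least \<open>i\<close>, above the earlier ratios
    \<open>k < i\<close>. Later ratios contain \<open>\<bar>u\<bar>\<close> to exceed the one at
    \<open>i + 1\<close>.\<close>
  define t where "t = \<bar>v\<bar> + int i"
  define y where "y = (\<lambda>k\<in>{1..n}. if k < i then int k * s k else if k = i then v + t * s i
    else if k = i + 1 then u + t * s (i + 1) else (t + \<bar>u\<bar> + int k) * s k)"
  have yi: "y (i + 1) * s i - y i * s (i + 1) = g"
    using i uv by (simp add: y_def algebra_simps)
  have v: "v \<ge> - \<bar>v\<bar> * s i" "u \<le> \<bar>u\<bar> * s (i + 1)"
  proof -
    have "\<bar>v\<bar> * 1 \<le> \<bar>v\<bar> * s i" "\<bar>u\<bar> * 1 \<le> \<bar>u\<bar> * s (i + 1)"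
      using s by (intro mult_left_mono; simp)+
    thus "v \<ge> - \<bar>v\<bar> * s i" "u \<le> \<bar>u\<bar> * s (i + 1)" by auto
  qed
  have low: "int i * s i \<le> v + t * s i" using v(1) by (simp add: t_def algebra_simps)
  have "y \<in> lh_slab True 0"
    unfolding lh_slab_0_iff if_True
  proof (intro conjI impI ballI)
    show "y \<in> {1..n} \<rightarrow>\<^sub>E UNIV" by (auto simp: y_def)
    have "0 < int i * s i" using s i by simp
    thus "0 < y 1" if "n \<ge> 1" using i that low s_pos[of 1] by (auto simp: y_def)
    fix k assume k: "k \<in> {1..<n}"
    have sk: "s k > 0" "s (k + 1) > 0" using k s_pos by auto
    consider "k + 1 < i" | "k + 1 = i" | "k = i" | "k = i + 1" | "k > i + 1" by linarith
    thus "0 < y (k + 1) * s k - y k * s (k + 1)"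
    proof cases
      case 1
      thus ?thesis using k sk by (simp add: y_def algebra_simps)
    next
      case 2
      have "0 < s k * s (k + 1)" using sk by simp
      also have "\<dots> = (int (k + 1) * s (k + 1)) * s k - (int k * s k) * s (k + 1)"
        by (simp add: algebra_simps)
      also have "\<dots> \<le> (v + t * s i) * s k - (int k * s k) * s (k + 1)"
        using low sk 2 by (intro diff_right_mono mult_right_mono) auto
      finally show ?thesis using 2 k by (auto simp: y_def)
    next
      case 3
      thus ?thesis using yi g by simp
    next
      case 4
      have "0 < int (k + 1) * (s k * s (k + 1))" using sk by simp
      also have "\<dots> = ((t + \<bar>u\<bar> + int (k + 1)) * s (k + 1)) * s k - (\<bar>u\<bar> * s k + t * s k) * s (k + 1)"
        by (simp add: algebra_simps)
      also have "\<dots> \<le> ((t + \<bar>u\<bar> + int (k + 1)) * s (k + 1)) * s k - (u + t * s k) * s (k + 1)"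
        using v(2) sk 4 by (intro diff_left_mono mult_right_mono) auto
      finally show ?thesis using 4 k by (simp add: y_def)
    next
      case 5
      thus ?thesis using k sk by (simp add: y_def algebra_simps)
    qed
  qed
  hence "vec_diff y c \<in> lh_slab False 0" by (rule assms(2))
  hence "0 \<le> vec_diff y c (i + 1) * s i - vec_diff y c i * s (i + 1)"
    using i unfolding lh_slab_0_iff by auto
  hence "c (i + 1) * s i - c i * s (i + 1) \<le> g"
    using i yi by (simp add: vec_diff_def algebra_simps)
  moreover have "0 < c (i + 1) * s i - c i * s (i + 1)"
    using c i unfolding lh_slab_0_iff by auto
  \<comment> \<open>A positive multiple of \<open>g\<close> that is at most \<open>g\<close> equals
    \<open>g\<close>.\<close>
  moreover have "g dvd c (i + 1) * s i - c i * s (i + 1)"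
    unfolding g_def by (intro dvd_diff dvd_mult) auto
  ultimately show ?thesis unfolding g_def using zdvd_imp_le by fastforce
qed

end

section \<open>Second-order recurrences\<close>

locale lecture_hall_recurrence =
  fixes l b :: int and s :: "nat \<Rightarrow> int"
  assumes l_pos: "l > 0" and b_nz: "b \<noteq> 0" and discr: "l ^ 2 + 4 * b \<ge> 0"
    and s0: "s 0 = 0" and s1: "s (Suc 0) = 1"
    and rec: "\<And>i. s (Suc (Suc i)) = l * s (Suc i) + b * s i"
begin

text \<open>For negative \<open>b\<close> positivity alone does not propagate. The invariant that
  consecutive ratios stay at least \<open>l/2\<close> does, thanks to the nonnegative
  discriminant.\<close>

lemma recurrence_pos_aux: "s (Suc i) > 0 \<and> l * s (Suc i) \<le> 2 * s (Suc (Suc i))"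
proof (induction i)
  case 0
  show ?case using l_pos by (simp add: rec s0 s1)
next
  case (Suc i)
  let ?x = "s (Suc i)" and ?y = "s (Suc (Suc i))"
  have "0 < l * ?x" using Suc l_pos by simp
  hence y: "?y > 0" using Suc by linarith
  have "l * (l * ?x) \<le> l * (2 * ?y)" using Suc l_pos by (intro mult_left_mono) auto
  moreover have "0 \<le> (l ^ 2 + 4 * b) * ?x" using discr Suc by simp
  ultimately have "l * ?y \<le> 2 * s (Suc (Suc (Suc i)))"
    unfolding rec[of "Suc i"] by (simp add: algebra_simps power2_eq_square)
  thus ?case using y by simp
qed

lemma recurrence_pos: "i \<ge> 1 \<Longrightarrow> s i > 0"
  using recurrence_pos_aux[of "i - 1"] by (cases i) auto

lemma recurrence_growth: "s i \<le> 2 * s (Suc i)"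
proof (cases i)
  case (Suc k)
  have "1 * s (Suc k) \<le> l * s (Suc k)"
    using l_pos recurrence_pos_aux[of k] by (intro mult_right_mono) auto
  hence "s (Suc k) \<le> l * s (Suc k)" by simp
  also have "\<dots> \<le> 2 * s (Suc (Suc k))" using recurrence_pos_aux[of k] by blast
  finally show ?thesis using Suc by simp
qed (simp add: s0 s1)

text \<open>A generalized Cassini identity: one step of the recurrence multiplies the determinant by
  \<open>- b\<close>. It serves to separate the ratios of consecutive terms and, with
  \<open>k = 1\<close>, to locate the apex for \<open>b = - 1\<close>.\<close>

lemma recurrence_casorati:
  "s (Suc (i + k)) * s i - s (Suc i) * s (i + k) = - ((- b) ^ i * s k)"
proof (induction i)
  case (Suc i)
  have "s (Suc (Suc i + k)) * s (Suc i) - s (Suc (Suc i)) * s (Suc i + k) =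
          - b * (s (Suc (i + k)) * s i - s (Suc i) * s (i + k))"
    by (simp add: rec algebra_simps)
  thus ?case using Suc by simp
qed (simp add: s0 s1)

section \<open>Greatest common divisors of consecutive terms\<close>

abbreviation (input) gcd_succ :: "nat \<Rightarrow> int" where
  "gcd_succ i \<equiv> gcd (s i) (s (Suc i))"

lemma gcd_succ_pos: "gcd_succ i > 0"
  using recurrence_pos[of "Suc i"] by simp

lemma gcd_succ_Suc_dvd: "gcd_succ (Suc i) dvd b * gcd_succ i"
proof -
  have "b * s i = s (Suc (Suc i)) - l * s (Suc i)" by (simp add: rec)
  hence "gcd_succ (Suc i) dvd b * s i" by simp
  hence "gcd_succ (Suc i) dvd gcd (b * s i) (b * s (Suc i))" by simp
  thus ?thesis by (simp add: gcd_mult_left)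
qed

text \<open>Two consecutive zeros force \<open>b < 0\<close> and factors \<open>b\<close> in the
  next two terms. After division by the gcd, \<open>gcd l b\<close> divides the coprime
  \<open>x\<close> and \<open>y\<close>, so \<open>l\<close> and \<open>b\<close> are coprime. Then
  \<open>b\<close> is coprime to every later term yet divides one of them, leaving only
  \<open>b = - 1\<close>.\<close>

lemma gcd_succ_not_geometric:
  assumes "b \<noteq> - 1" "b * gcd_succ i + gcd_succ (Suc i) = 0"
  shows "b * gcd_succ (Suc i) + gcd_succ (Suc (Suc i)) \<noteq> 0"
proof
  assume eq: "b * gcd_succ (Suc i) + gcd_succ (Suc (Suc i)) = 0"
  define g where "g = gcd_succ i"
  have g: "g > 0" unfolding g_def by (rule gcd_succ_pos)
  have "b * g = - gcd_succ (Suc i)" using assms(2) by (simp add: g_def)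
  hence "b * g < 0" using gcd_succ_pos[of "Suc i"] by simp
  hence b: "b < 0" using g by (simp add: mult_less_0_iff)
  obtain x y where xy: "s i = g * x" "s (Suc i) = g * y" "coprime x y"
    using g gcd_coprime_exists[of "s i" "s (Suc i)"]
    unfolding g_def[symmetric] mult.commute[of _ g] by auto
  have g1: "gcd_succ (Suc i) = - b * g" using assms(2) by (simp add: g_def)
  have "- b * g dvd g * y" using xy(2) by (metis g1 gcd_dvd1)
  hence "b dvd y" using g by (simp add: mult.commute)
  then obtain y' where y': "y = b * y'" by blast
  have "b * b * g dvd s (Suc (Suc i))"
  proof -
    have "gcd_succ (Suc (Suc i)) = b * b * g" using eq unfolding g1 by simp
    thus ?thesis by (metis gcd_dvd1)
  qed
  also have "s (Suc (Suc i)) = (b * g) * (l * y' + x)"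
    by (simp add: rec xy y' algebra_simps)
  finally have "b dvd l * y' + x" using g b by (simp add: mult.assoc mult.left_commute[of _ g])
  hence "gcd l b dvd l * y' + x" by (meson dvd_trans gcd_dvd2)
  hence "gcd l b dvd x" by (simp add: dvd_add_right_iff)
  moreover have "gcd l b dvd y" unfolding y' by simp
  ultimately have "coprime l b" using xy(3) by (metis coprime_common_divisor coprime_iff_gcd_eq_1 is_unit_gcd_iff)
  hence "coprime (s (Suc k)) b" for k
  proof (induction k)
    case (Suc k)
    \<comment> \<open>Modulo \<open>b\<close> the recurrence is multiplication by
      \<open>l\<close>.\<close>
    have "gcd (s (Suc (Suc k))) b = gcd (l * s (Suc k)) b"
      unfolding rec by (metis gcd.commute gcd_add_mult mult.commute add.commute)
    moreover have "coprime (l * s (Suc k)) b" using Suc \<open>coprime l b\<close> by simp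
    ultimately show ?case by (simp only: coprime_iff_gcd_eq_1)
  qed (simp add: s1)
  hence "coprime (s (Suc i)) b" .
  moreover have "b dvd s (Suc i)" unfolding xy y' by simp
  ultimately have "is_unit b" by (metis coprime_absorb_right coprime_commute)
  thus False using b assms(1) by (auto simp: zdvd1_eq)
qed

lemma gcd_succ_divisibility_fails:
  assumes "b \<noteq> - 1"
  shows "\<exists>i\<ge>1. \<not> s (Suc i) dvd b * gcd_succ i + gcd_succ (Suc i)"
proof (rule ccontr)
  assume "\<not> ?thesis"
  hence dvd: "s (Suc i) dvd b * gcd_succ i + gcd_succ (Suc i)" if "i \<ge> 1" for i
    using that by blast
  \<comment> \<open>Divisibility bounds \<open>s (Suc i)\<close> only where the number it divides is
    nonzero.\<close>
  define J where "J = {i. i \<ge> 1 \<and> b * gcd_succ i + gcd_succ (Suc i) \<noteq> 0}"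
  have "\<exists>m\<ge>i. m \<in> J" for i
    using gcd_succ_not_geometric[OF assms, of "Suc i"] unfolding J_def
    by (cases "b * gcd_succ (Suc i) + gcd_succ (Suc (Suc i)) = 0")
       (auto intro: exI[of _ "Suc (Suc i)"] exI[of _ "Suc i"])
  hence inf: "infinite J" by (simp add: infinite_nat_iff_unbounded_le)
  \<comment> \<open>The reduced fraction of consecutive terms, as a pair; it will map the infinite
    set \<open>J\<close> injectively into a finite box.\<close>
  define h where "h i = (s i div gcd_succ i, s (Suc i) div gcd_succ i)" for i
  have h: "s i = gcd_succ i * fst (h i)" "s (Suc i) = gcd_succ i * snd (h i)" for i
    by (simp_all add: h_def)
  have "inj_on h J"
  proof (rule linorder_inj_onI)
    fix i j assume ij: "i < j" "i \<in> J" "j \<in> J"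
    define k where "k = j - i"
    have k: "j = i + k" "k \<ge> 1" using ij(1) by (auto simp: k_def)
    \<comment> \<open>Equal reduced fractions would annihilate this determinant, which is a power of
      \<open>- b\<close> times a positive term, up to sign.\<close>
    have "s (Suc j) * s i - s (Suc i) * s j \<noteq> 0"
      unfolding k(1) recurrence_casorati using b_nz recurrence_pos[OF k(2)] by simp
    moreover have "s (Suc j) * s i - s (Suc i) * s j = 0" if "h i = h j"
      using h[of i] h[of j] that by (metis (no_types) eq_iff_diff_eq_0 mult.commute mult.left_commute)
    ultimately show "h i \<noteq> h j" by blast
  qed auto
  moreover have "h ` J \<subseteq> {0..4 * \<bar>b\<bar>} \<times> {0..2 * \<bar>b\<bar>}"
  proof
    fix z assume "z \<in> h ` J"
    then obtain i where i: "z = h i" "i \<ge> 1" "b * gcd_succ i + gcd_succ (Suc i) \<noteq> 0"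
      unfolding J_def by blast
    define g where "g = gcd_succ i"
    have g: "g > 0" unfolding g_def by (rule gcd_succ_pos)
    have "gcd_succ (Suc i) \<le> \<bar>b * g\<bar>"
      unfolding g_def using b_nz gcd_succ_pos[of i]
      by (intro zdvd_imp_le) (use gcd_succ_Suc_dvd[of i] in auto)
    moreover have "s (Suc i) \<le> \<bar>b * g + gcd_succ (Suc i)\<bar>"
      unfolding g_def using dvd[OF i(2)] i(3) by (intro zdvd_imp_le) auto
    ultimately have "s (Suc i) \<le> 2 * \<bar>b * g\<bar>"
      using gcd_succ_pos[of "Suc i"] by linarith
    hence up: "s (Suc i) \<le> g * (2 * \<bar>b\<bar>)" using g by (simp add: abs_mult mult_ac)
    have "s i \<le> g * (4 * \<bar>b\<bar>)" using up recurrence_growth[of i] by simp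
    moreover have "s i = g * fst (h i)" "s (Suc i) = g * snd (h i)" unfolding g_def by (rule h)+
    ultimately have "fst (h i) \<le> 4 * \<bar>b\<bar>" "snd (h i) \<le> 2 * \<bar>b\<bar>"
      using up g by (metis mult_le_cancel_left_pos)+
    moreover have "0 \<le> fst (h i)" "0 \<le> snd (h i)"
      using recurrence_pos[OF i(2)] recurrence_pos[of "Suc i"] g
      by (auto simp: h_def g_def pos_imp_zdiv_nonneg_iff)
    ultimately show "z \<in> {0..4 * \<bar>b\<bar>} \<times> {0..2 * \<bar>b\<bar>}"
      unfolding i(1) by (auto simp: mem_Times_iff)
  qed
  ultimately have "finite J" by (metis finite_SigmaI finite_atLeastAtMost_int finite_imageD finite_subset)
  thus False using inf by blast
qed

text \<open>In \<open>b\<close> times the height relation at \<open>i\<close> plus the one at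
  \<open>Suc i\<close>, the recurrence cancels every term without the factor
  \<open>s (Suc i)\<close>.\<close>

lemma self_reciprocal_imp_divisibility:
  assumes "self_reciprocal (lecture_hall_gf s n)" "i \<ge> 1" "Suc i < n"
  shows "s (Suc i) dvd b * gcd_succ i + gcd_succ (Suc i)"
proof -
  interpret positive_sequence s n by unfold_locales (rule recurrence_pos)
  obtain c where c: "c \<in> lh_slab True 0"
    "\<And>y. y \<in> lh_slab True 0 \<Longrightarrow> vec_diff y c \<in> lh_slab False 0"
    using assms(1) self_reciprocal_iff_translate by blast
  have facet: "c (Suc k) * s k - c k * s (Suc k) = gcd_succ k" if "k \<ge> 1" "k < n" for k
    using translate_facet_gcd[OF c, of k] that by simp
  have "b * gcd_succ i + gcd_succ (Suc i) = s (Suc i) * (c (Suc (Suc i)) - b * c i - l * c (Suc i))"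
    unfolding facet[of i, symmetric, OF assms(2) Suc_lessD[OF assms(3)]]
      facet[of "Suc i", symmetric, OF _ assms(3), simplified]
    by (simp add: rec algebra_simps)
  thus ?thesis by simp
qed

text \<open>The point \<open>c\<close> has height exactly 1 above every facet. Interior integer
  points have height at least 1, so subtracting \<open>c\<close> keeps them in the cone.\<close>

lemma self_reciprocal_minus_one:
  assumes "b = - 1"
  shows "self_reciprocal (lecture_hall_gf s n)"
proof -
  interpret positive_sequence s n by unfold_locales (rule recurrence_pos)
  define c where "c = (\<lambda>i\<in>{1..n}. s i + s (i - 1))"
  have facet: "c (i + 1) * s i - c i * s (i + 1) = 1" if i: "i \<in> {1..<n}" for i
  proof -
    obtain k where k: "i = Suc k" using i by (cases i) auto
    have "s (Suc (Suc k)) * s k - s (Suc k) * s (Suc k) = - 1"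
      using recurrence_casorati[of k 1] assms by (simp add: s1)
    thus ?thesis using i by (simp add: c_def k algebra_simps)
  qed
  have c1: "c 1 = 1" if "n \<ge> 1" using that by (simp add: c_def s0 s1)
  have "c \<in> lh_slab True 0"
    unfolding lh_slab_0_iff using facet c1 by (auto simp: c_def)
  moreover have "vec_diff y c \<in> lh_slab False 0" if y: "y \<in> lh_slab True 0" for y
    unfolding lh_slab_0_iff if_False
  proof (intro conjI impI ballI)
    show "vec_diff y c \<in> {1..n} \<rightarrow>\<^sub>E UNIV" by (rule vec_diff_in)
    show "0 \<le> vec_diff y c 1" if "n \<ge> 1"
      using y c1[OF that] that unfolding lh_slab_0_iff by (auto simp: vec_diff_def)
    fix i assume i: "i \<in> {1..<n}"
    have "0 < y (i + 1) * s i - y i * s (i + 1)" using y i unfolding lh_slab_0_iff by auto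
    thus "0 \<le> vec_diff y c (i + 1) * s i - vec_diff y c i * s (i + 1)"
      using i facet[OF i] by (simp add: vec_diff_def algebra_simps)
  qed
  ultimately show ?thesis
    using self_reciprocal_iff_translate by blast
qed

end

theorem theorem1p4:
  fixes l b :: int and s :: "nat \<Rightarrow> int"
  assumes "l > 0" and "b \<noteq> 0" and "l ^ 2 + 4 * b \<ge> 0"
    and "s 0 = 0" and "s 1 = 1"
    and "\<And>n. n \<ge> 2 \<Longrightarrow> s n = l * s (n - 1) + b * s (n - 2)"
  shows "((\<forall>n. self_reciprocal (lecture_hall_gf s n)) \<longleftrightarrow> b = -1) \<and>
         (b \<noteq> -1 \<longrightarrow>
           (\<exists>n0. \<forall>n\<ge>n0.
              \<not> self_reciprocal (lecture_hall_gf s n) \<and>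
              \<not> (\<exists>e :: nat \<Rightarrow> nat. (\<forall>i\<in>{1..n}. e i > 0) \<and>
                    lecture_hall_gf s n = inverse (\<Prod>i=1..n. 1 - ratfun_q ^ e i))))"
proof -
  interpret lecture_hall_recurrence l b s
    using assms(1-5) assms(6)[of "Suc (Suc _)"] by unfold_locales auto
  have "\<exists>n0. \<forall>n\<ge>n0. \<not> self_reciprocal (lecture_hall_gf s n)" if b: "b \<noteq> - 1"
  proof -
    obtain i where "i \<ge> 1" "\<not> s (Suc i) dvd b * gcd (s i) (s (Suc i)) + gcd (s (Suc i)) (s (Suc (Suc i)))"
      using gcd_succ_divisibility_fails[OF b] by blast
    \<comment> \<open>From \<open>n = i + 2\<close> on, both facet relations at \<open>i\<close> and
      \<open>Suc i\<close> are available.\<close>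
    hence "\<forall>n\<ge>i + 2. \<not> self_reciprocal (lecture_hall_gf s n)"
      using self_reciprocal_imp_divisibility by fastforce
    thus ?thesis by blast
  qed
  \<comment> \<open>A product of this form is self-reciprocal, so it is excluded wherever
    self-reciprocity fails.\<close>
  moreover have "self_reciprocal (lecture_hall_gf s n)"
    if "\<forall>i\<in>{1..n}. e i > 0" "lecture_hall_gf s n = inverse (\<Prod>i=1..n. 1 - ratfun_q ^ e i)" for n e
    unfolding that(2) using that(1) by (intro self_reciprocal_inverse_one_minus_prod) auto
  ultimately show ?thesis
    using self_reciprocal_minus_one by (metis order_refl)
qed

end
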